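(* For every graph $G$ and every 2-switch $\tau$ on $G$, $|\mu(\tau(G))-\mu(G)|\le 1$, where $\mu$ denotes the matching number.
   Context: Graphs are finite and simple. A 2-switch on $G$ is specified by four distinct vertices $a,b,c,d$ with $ab,cd\in E(G)$ and $ac,bd\notin E(G)$; it produces $\tau(G)=G-ab-cd+ac+bd$. The matching number $\mu(G)$ is the maximum size of a set of pairwise disjoint edges of $G$. *)

theory Defs
  imports Main "HOL-Library.Disjoint_Sets"
begin

record 'a ugraph =
  verts :: "'a set"
  edges :: "'a set set"

definition simple_graph :: "'a ugraph \<Rightarrow> bool" where
  "simple_graph G \<longleftrightarrow>
     finite (verts G) \<and> (\<forall>e\<in>edges G. e \<subseteq> verts G \<and> card e = 2)"

text \<open>A 2-switch is given by the ordered quadruple \<open>(a, b, c, d)\<close>;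
  \<open>is_two_switch\<close> is its admissibility on \<open>G\<close> and \<open>two_switch\<close> the resulting graph.\<close>

definition is_two_switch :: "'a ugraph \<Rightarrow> 'a \<Rightarrow> 'a \<Rightarrow> 'a \<Rightarrow> 'a \<Rightarrow> bool" where
  "is_two_switch G a b c d \<longleftrightarrow>
     {a, b, c, d} \<subseteq> verts G \<and> distinct [a, b, c, d] \<and>
     {a, b} \<in> edges G \<and> {c, d} \<in> edges G \<and>
     {a, c} \<notin> edges G \<and> {b, d} \<notin> edges G"

definition two_switch :: "'a ugraph \<Rightarrow> 'a \<Rightarrow> 'a \<Rightarrow> 'a \<Rightarrow> 'a \<Rightarrow> 'a ugraph" where
  "two_switch G a b c d =
     \<lparr>verts = verts G, edges = (edges G - {{a, b}, {c, d}}) \<union> {{a, c}, {b, d}}\<rparr>"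

definition matching :: "'a ugraph \<Rightarrow> 'a set set \<Rightarrow> bool" where
  "matching G M \<longleftrightarrow> M \<subseteq> edges G \<and> disjoint M"

definition matching_number :: "'a ugraph \<Rightarrow> nat" where
  "matching_number G = Max {card M | M. matching G M}"

text \<open>The maximum is over a finite nonempty set, so it is attained.\<close>

lemma simple_graph_finite_edges: "simple_graph G \<Longrightarrow> finite (edges G)"
  unfolding simple_graph_def by (rule finite_subset[of _ "Pow (verts G)"]) auto

lemma finite_matching_cards:
  assumes "simple_graph G" shows "finite {card M | M. matching G M}"
proof -
  have "{card M | M. matching G M} \<subseteq> card ` Pow (edges G)"
    by (auto simp: matching_def)
  then show ?thesis
    using simple_graph_finite_edges[OF assms] by (meson finite_Pow_iff finite_imageI finite_subset)
qed

lemma matching_empty: "matching G {}"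
  by (simp add: matching_def)

lemma simple_graph_two_switch:
  assumes "simple_graph G" "is_two_switch G a b c d"
  shows "simple_graph (two_switch G a b c d)"
  using assms by (auto simp: simple_graph_def is_two_switch_def two_switch_def)

end

theory Submission
  imports Defs
begin

text \<open>Given a maximum matching of \<open>G\<close>, if it contains both removed edges \<open>ab\<close> and \<open>cd\<close>,
  swap them for \<open>ac\<close> and \<open>bd\<close>, which cover the same four vertices; otherwise at most one
  edge is lost. Since a 2-switch is undone by a 2-switch, the bound is symmetric.\<close>

lemma card_le_matching_number:
  assumes "simple_graph G" "matching G M"
  shows "card M \<le> matching_number G"
  unfolding matching_number_def
  using assms by (intro Max_ge finite_matching_cards) auto

lemma obtain_maximum_matching:
  assumes "simple_graph G"
  obtains M where "matching G M" "card M = matching_number G"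
proof -
  have "matching_number G \<in> {card M | M. matching G M}"
    unfolding matching_number_def
    using finite_matching_cards[OF assms] matching_empty by (intro Max_in) auto
  then show thesis using that by auto
qed

lemma matching_finite:
  assumes "simple_graph G" "matching G M"
  shows "finite M"
  using assms simple_graph_finite_edges finite_subset by (auto simp: matching_def)

text \<open>Exchanging \<open>b\<close> and \<open>c\<close> swaps the roles of removed and added
  edges. Distinctness of the four vertices keeps \<open>{a, b}\<close> and \<open>{c, d}\<close>
  different from the added pairs, so they really are non-edges after the switch.\<close>

lemma is_two_switch_reverse:
  assumes "is_two_switch G a b c d"
  shows "is_two_switch (two_switch G a b c d) a c b d"
  using assms by (auto simp: is_two_switch_def two_switch_def doubleton_eq_iff)

text \<open>Admissibility makes the cancellation exact: the pairs deleted again were absent from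
  \<open>G\<close>, and the pairs put back were present.\<close>

lemma two_switch_reverse:
  assumes "is_two_switch G a b c d"
  shows "two_switch (two_switch G a b c d) a c b d = G"
proof -
  have "edges G - {{a, b}, {c, d}} \<union> {{a, c}, {b, d}} - {{a, c}, {b, d}} \<union> {{a, b}, {c, d}} = edges G"
    using assms unfolding is_two_switch_def by blast
  then show ?thesis by (simp add: two_switch_def)
qed

lemma matching_number_le_two_switch:
  assumes G: "simple_graph G" and sw: "is_two_switch G a b c d"
  shows "matching_number G \<le> matching_number (two_switch G a b c d) + 1"
proof -
  let ?H = "two_switch G a b c d"
  obtain M where M: "matching G M" "card M = matching_number G"
    using obtain_maximum_matching[OF G] .
  have fin: "finite M" using matching_finite[OF G M(1)] .
  \<comment> \<open>\<open>R\<close> is the part of \<open>M\<close> that survives the switch, hence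
    a matching in both graphs.\<close>
  define R where "R = M - {{a, b}, {c, d}}"
  have R: "finite R" "matching ?H R"
    using M(1) fin by (auto simp: R_def matching_def two_switch_def disjoint_def)
  have "\<exists>N. matching ?H N \<and> card M \<le> card N + 1"
  proof (cases "{a, b} \<in> M \<and> {c, d} \<in> M")
    case True
    \<comment> \<open>As \<open>M\<close> contains both removed edges, the other edges of
      \<open>M\<close> avoid all four vertices, which leaves room for \<open>{a, c}\<close> and
      \<open>{b, d}\<close>.\<close>
    have ab: "e \<inter> {a, b} = {}" and cd: "e \<inter> {c, d} = {}" if "e \<in> R" for e
      using that True M(1) disjointD[of M e] by (simp_all add: R_def matching_def)
    have dist: "distinct [a, b, c, d]" using sw by (simp add: is_two_switch_def)
    have R_disj: "\<And>e f. e \<in> R \<Longrightarrow> f \<in> R \<Longrightarrow> e \<noteq> f \<Longrightarrow> e \<inter> f = {}"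
      using R(2) by (simp add: matching_def disjoint_def)
    have "disjoint (insert {a, c} (insert {b, d} R))"
      unfolding disjoint_def using R_disj ab cd dist by auto
    then have "matching ?H (insert {a, c} (insert {b, d} R))"
      using R(2) by (auto simp: matching_def two_switch_def)
    moreover have "card (insert {a, c} (insert {b, d} R)) = card R + 2"
    proof -
      have "{a, c} \<notin> R" "{b, d} \<notin> R" "{a, c} \<noteq> {b, d}"
        using ab dist by (auto simp: doubleton_eq_iff)
      then show ?thesis using R(1) by simp
    qed
    moreover have "card M \<le> card R + 2"
    proof -
      have "M \<subseteq> insert {a, b} (insert {c, d} R)" by (auto simp: R_def)
      then have "card M \<le> card (insert {a, b} (insert {c, d} R))"
        using R(1) by (intro card_mono) auto
      also have "\<dots> \<le> card R + 2"
        using R(1) by (simp add: card_insert_if)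
      finally show ?thesis .
    qed
    ultimately show ?thesis by auto
  next
    case False
    \<comment> \<open>The witness \<open>x\<close> need not lie in \<open>M\<close>: if
      \<open>M\<close> contains neither removed edge, \<open>{c, d}\<close> still serves.\<close>
    then have "\<exists>x. R = M - {x}"
    proof (cases "{a, b} \<in> M")
      case True
      with False have "R = M - {{a, b}}" by (auto simp: R_def)
      then show ?thesis ..
    next
      case False
      then have "R = M - {{c, d}}" by (auto simp: R_def)
      then show ?thesis ..
    qed
    then have "card M \<le> card R + 1"
      using fin by (auto simp: card_Diff_singleton_if)
    then show ?thesis using R(2) by blast
  qed
  then show ?thesis
    using card_le_matching_number[OF simple_graph_two_switch[OF G sw]] M(2) by fastforce
qed

theorem mainTheorem9:
  fixes G :: "'a ugraph" and a b c d :: 'a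
  assumes "simple_graph G"
    and "is_two_switch G a b c d"
  shows "\<bar>int (matching_number (two_switch G a b c d)) - int (matching_number G)\<bar> \<le> 1"
  \<comment> \<open>The two one-sided bounds come from the switch on \<open>G\<close> and from its
    reverse on the switched graph, which leads back to \<open>G\<close>.\<close>
  using matching_number_le_two_switch[OF assms]
    matching_number_le_two_switch[OF simple_graph_two_switch[OF assms] is_two_switch_reverse[OF assms(2)]]
  by (simp add: two_switch_reverse[OF assms(2)])

end
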